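(* Let $(G^{(n)})_{n\ge1}$ be a sequence of finite non-abelian CA groups. Let $Z^{(n)}$ be the center of $G^{(n)}$, let $c^{(n)}_\star=\max\{|C^{(n)}_x|: x\in G^{(n)}\setminus Z^{(n)}\}$, where $C_x^{(n)}$ is the centralizer of $x$ in $G^{(n)}$, and let $C^{(n)}_\star$ be any centralizer of a non-central element with $|C^{(n)}_\star|=c^{(n)}_\star$. Let $\pi^{(n)}$ be the stationary distribution of the commuting chain on $G^{(n)}$ and let $\lambda^{(n)}_\star$ be the absolute second largest eigenvalue of its transition matrix. If $\pi^{(n)}(C^{(n)}_\star\setminus Z^{(n)})\le\frac12$ for all $n$ and $\lambda^{(n)}_\star\to1$ as $n\to\infty$, then the sequence of commuting chains on $G^{(n)}$ does not exhibit cutoff.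
   Context: For a finite group $G$ with center $Z$ and $x\in G$, let $C_x=\{h\in G: hx=xh\}$ be the centralizer and $x^G$ the conjugacy class of $x$. $G$ is a CA group if commutativity is a transitive relation on $G\setminus Z$ (equivalently, the centralizer of every non-central element is abelian). The commuting chain on $G$ is the Markov chain with state space $G$ and transition matrix $P(x,y)=\frac{1}{|C_x|}\mathbf 1_{\{xy=yx\}}$; it is irreducible, aperiodic and reversible with stationary distribution $\pi(x)=\frac{1}{k|x^G|}$, where $k$ is the number of conjugacy classes of $G$. If the (real) eigenvalues of $P$, with multiplicity, are $1=\lambda_1>\lambda_2\ge\dots\ge\lambda_{|G|}>-1$, the absolute second largest eigenvalue is $\lambda_\star=\max\{\lambda_2,|\lambda_{|G|}|\}$. Total variation distance: $\Vert\mu-\nu\Vert_{TV}=\sup_{A}|\mu(A)-\nu(A)|$. Put $d(t)=\max_x\Vert P^t(x,\cdot)-\pi\Vert_{TV}$ and $t_{mix}(\varepsilon)=\min\{t: d(t)\le\varepsilon\}$. A sequence of chains with mixing times $t^{(n)}_{mix}(\varepsilon)$ exhibits cutoff if $\lim_{n\to\infty} t^{(n)}_{mix}(\varepsilon)/t^{(n)}_{mix}(1-\varepsilon)=1$ for all $\varepsilon\in(0,1)$. *)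

theory Defs
  imports "HOL-Library.Countable_Set" "HOL-Algebra.Group_Action" "Jordan_Normal_Form.Char_Poly"
begin

definition centralizer :: "('a, 'b) monoid_scheme \<Rightarrow> 'a \<Rightarrow> 'a set"
  where "centralizer G x = {h \<in> carrier G. h \<otimes>\<^bsub>G\<^esub> x = x \<otimes>\<^bsub>G\<^esub> h}"

definition center :: "('a, 'b) monoid_scheme \<Rightarrow> 'a set"
  where "center G = {z \<in> carrier G. \<forall>x \<in> carrier G. z \<otimes>\<^bsub>G\<^esub> x = x \<otimes>\<^bsub>G\<^esub> z}"

definition CA_group :: "('a, 'b) monoid_scheme \<Rightarrow> bool"
  where "CA_group G \<longleftrightarrow> group G \<and>
    (\<forall>x \<in> carrier G - center G. \<forall>y \<in> carrier G - center G. \<forall>z \<in> carrier G - center G.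
       x \<otimes>\<^bsub>G\<^esub> y = y \<otimes>\<^bsub>G\<^esub> x \<longrightarrow> y \<otimes>\<^bsub>G\<^esub> z = z \<otimes>\<^bsub>G\<^esub> y \<longrightarrow> x \<otimes>\<^bsub>G\<^esub> z = z \<otimes>\<^bsub>G\<^esub> x)"

definition max_centralizer_card :: "('a, 'b) monoid_scheme \<Rightarrow> nat"
  where "max_centralizer_card G = Max {card (centralizer G x) | x. x \<in> carrier G - center G}"

text \<open>A chain is given by a finite set \<open>S\<close> of states and a transition function
  \<open>P :: 'a \<Rightarrow> 'a \<Rightarrow> real\<close>; only the values on \<open>S\<close> matter.\<close>

fun step_prob :: "'a set \<Rightarrow> ('a \<Rightarrow> 'a \<Rightarrow> real) \<Rightarrow> nat \<Rightarrow> 'a \<Rightarrow> 'a \<Rightarrow> real"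
  where
    "step_prob S P 0 x y = (if x = y then 1 else 0)"
  | "step_prob S P (Suc t) x y = (\<Sum>z\<in>S. step_prob S P t x z * P z y)"

definition stationary_distribution :: "'a set \<Rightarrow> ('a \<Rightarrow> 'a \<Rightarrow> real) \<Rightarrow> ('a \<Rightarrow> real) \<Rightarrow> bool"
  where "stationary_distribution S P \<pi> \<longleftrightarrow>
    (\<forall>x\<in>S. 0 \<le> \<pi> x) \<and> (\<Sum>x\<in>S. \<pi> x) = 1 \<and> (\<forall>y\<in>S. (\<Sum>x\<in>S. \<pi> x * P x y) = \<pi> y)"

text \<open>The state space is enumerated by \<open>from_nat_into S\<close>, which for finite \<open>S\<close> is a bijection
  from \<open>{..<card S}\<close> onto \<open>S\<close>. The spectrum does not depend on the enumeration.\<close>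

definition transition_mat :: "'a set \<Rightarrow> ('a \<Rightarrow> 'a \<Rightarrow> real) \<Rightarrow> real mat"
  where "transition_mat S P =
    mat (card S) (card S) (\<lambda>(i, j). P (from_nat_into S i) (from_nat_into S j))"

text \<open>The real eigenvalues, with algebraic multiplicity, in decreasing order. For a reversible
  chain these are all eigenvalues, so that the list has length \<open>card S\<close>.\<close>

definition eigenvalue_list :: "'a set \<Rightarrow> ('a \<Rightarrow> 'a \<Rightarrow> real) \<Rightarrow> real list"
  where "eigenvalue_list S P =
    rev (sorted_list_of_multiset (proots (char_poly (transition_mat S P))))"

definition abs_second_eigenvalue :: "'a set \<Rightarrow> ('a \<Rightarrow> 'a \<Rightarrow> real) \<Rightarrow> real"
  where "abs_second_eigenvalue S P =
    max (eigenvalue_list S P ! 1) \<bar>last (eigenvalue_list S P)\<bar>"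

definition tv_dist :: "'a set \<Rightarrow> ('a \<Rightarrow> real) \<Rightarrow> ('a \<Rightarrow> real) \<Rightarrow> real"
  where "tv_dist S \<mu> \<nu> = (SUP A\<in>Pow S. \<bar>(\<Sum>x\<in>A. \<mu> x) - (\<Sum>x\<in>A. \<nu> x)\<bar>)"

definition dist_to_stationary ::
    "'a set \<Rightarrow> ('a \<Rightarrow> 'a \<Rightarrow> real) \<Rightarrow> ('a \<Rightarrow> real) \<Rightarrow> nat \<Rightarrow> real"
  where "dist_to_stationary S P \<pi> t = Max ((\<lambda>x. tv_dist S (step_prob S P t x) \<pi>) ` S)"

definition mixing_time ::
    "'a set \<Rightarrow> ('a \<Rightarrow> 'a \<Rightarrow> real) \<Rightarrow> ('a \<Rightarrow> real) \<Rightarrow> real \<Rightarrow> nat"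
  where "mixing_time S P \<pi> \<epsilon> = (LEAST t. dist_to_stationary S P \<pi> t \<le> \<epsilon>)"

text \<open>The argument \<open>T n \<epsilon>\<close> is the mixing time of the \<open>n\<close>-th chain.\<close>

definition exhibits_cutoff :: "(nat \<Rightarrow> real \<Rightarrow> nat) \<Rightarrow> bool"
  where "exhibits_cutoff T \<longleftrightarrow>
    (\<forall>\<epsilon>\<in>{0<..<1}. (\<lambda>n. real (T n \<epsilon>) / real (T n (1 - \<epsilon>))) \<longlonglongrightarrow> 1)"

definition commuting_chain :: "('a, 'b) monoid_scheme \<Rightarrow> 'a \<Rightarrow> 'a \<Rightarrow> real"
  where "commuting_chain G x y =
    (if x \<otimes>\<^bsub>G\<^esub> y = y \<otimes>\<^bsub>G\<^esub> x then 1 / real (card (centralizer G x)) else 0)"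

definition conjugation :: "('a, 'b) monoid_scheme \<Rightarrow> 'a \<Rightarrow> 'a \<Rightarrow> 'a"
  where "conjugation G = (\<lambda>g. \<lambda>h \<in> carrier G. g \<otimes>\<^bsub>G\<^esub> h \<otimes>\<^bsub>G\<^esub> inv\<^bsub>G\<^esub> g)"

text \<open>The commuting chain has exactly one stationary distribution: the reciprocal of the number
  of conjugacy classes times the size of the class of \<open>x\<close>.\<close>

context group
begin

lemma centralizer_eq_stabilizer:
  assumes "x \<in> carrier G"
  shows "centralizer G x = stabilizer G (conjugation G) x"
proof -
  have "h \<otimes> x = x \<otimes> h \<longleftrightarrow> h \<otimes> x \<otimes> inv h = x" if "h \<in> carrier G" for h
    using that assms by (metis inv_solve_right m_closed)
  then show ?thesis
    using assms by (auto simp: centralizer_def stabilizer_def conjugation_def)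
qed

lemma class_times_centralizer:
  assumes "x \<in> carrier G"
  shows "card (orbit G (conjugation G) x) * card (centralizer G x) = card (carrier G)"
  using group_action.orbit_stabilizer_theorem[OF action_by_conjugation assms]
    centralizer_eq_stabilizer[OF assms]
  by (simp add: conjugation_def Coset.order_def)

lemma stationary_distribution_commuting_chain_iff:
  assumes fin: "finite (carrier G)"
  shows "stationary_distribution (carrier G) (commuting_chain G) \<mu> \<longleftrightarrow>
    (\<forall>x \<in> carrier G. \<mu> x =
       1 / (real (card (orbits G (carrier G) (conjugation G))) *
            real (card (orbit G (conjugation G) x))))"
proof -
  define N where "N = real (card (carrier G))"
  define k where "k = real (card (orbits G (carrier G) (conjugation G)))"
  define c where "c x = real (card (centralizer G x))" for x
  define w where "w x = real (card (orbit G (conjugation G) x))" for x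
  have N: "N > 0"
    unfolding N_def using fin by (auto simp: card_gt_0_iff)
  have wc: "w x * c x = N" if "x \<in> carrier G" for x
    using class_times_centralizer[OF that]
    unfolding w_def c_def N_def by (metis of_nat_mult)
  have cpos: "c x > 0" and wpos: "w x > 0" if "x \<in> carrier G" for x
    using wc[OF that] N unfolding w_def c_def by (auto simp: zero_less_mult_iff)
  have inv_eq: "invariants (carrier G) (conjugation G) g = centralizer G g"
    if "g \<in> carrier G" for g
  proof -
    have "h \<otimes> g = g \<otimes> h \<longleftrightarrow> g \<otimes> h \<otimes> inv g = h" if "h \<in> carrier G" for h
      using that \<open>g \<in> carrier G\<close> by (metis inv_solve_right m_closed)
    then show ?thesis
      using that by (auto simp: invariants_def centralizer_def conjugation_def)
  qed
  have "card (orbits G (carrier G) (conjugation G)) * card (carrier G) =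
      (\<Sum>g\<in>carrier G. card (invariants (carrier G) (conjugation G) g))"
    using group_action.burnside[OF action_by_conjugation fin fin]
    by (simp add: conjugation_def Coset.order_def)
  then have "card (orbits G (carrier G) (conjugation G)) * card (carrier G) =
      (\<Sum>g\<in>carrier G. card (centralizer G g))"
    by (simp add: inv_eq)
  then have kN: "(\<Sum>x\<in>carrier G. c x) = k * N"
    unfolding c_def k_def N_def by (metis of_nat_mult of_nat_sum)
  have "(\<Sum>x\<in>carrier G. c x) > 0"
    using fin cpos by (intro sum_pos) auto
  then have k: "k > 0"
    using kN N by (auto simp: zero_less_mult_iff)
  have form: "1 / (k * w x) = c x / (k * N)" if "x \<in> carrier G" for x
    using wc[OF that] wpos[OF that] k N by (simp add: field_simps)
  have sumP: "(\<Sum>y\<in>carrier G. f y * (if x \<otimes> y = y \<otimes> x then 1 else 0)) =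
      (\<Sum>y\<in>centralizer G x. f y)" for x and f :: "'a \<Rightarrow> real"
  proof -
    have "(\<Sum>y\<in>carrier G. f y * (if x \<otimes> y = y \<otimes> x then 1 else 0)) =
        (\<Sum>y\<in>carrier G. if y \<otimes> x = x \<otimes> y then f y else 0)"
      by (intro sum.cong) auto
    also have "\<dots> = (\<Sum>y\<in>centralizer G x. f y)"
      unfolding centralizer_def using sum.inter_filter[OF fin] by metis
    finally show ?thesis .
  qed
  have push: "(\<Sum>x\<in>carrier G. \<mu> x * commuting_chain G x y) =
      (\<Sum>x\<in>centralizer G y. \<mu> x / c x)" for \<mu> y
  proof -
    have "(\<Sum>x\<in>carrier G. \<mu> x * commuting_chain G x y) =
        (\<Sum>x\<in>carrier G. (\<mu> x / c x) * (if y \<otimes> x = x \<otimes> y then 1 else 0))"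
      by (intro sum.cong) (auto simp: commuting_chain_def c_def)
    then show ?thesis
      by (simp only: sumP)
  qed
  have cent_sub: "centralizer G x \<subseteq> carrier G" for x
    by (auto simp: centralizer_def)
  have "stationary_distribution (carrier G) (commuting_chain G) \<mu> \<longleftrightarrow>
      (\<forall>x \<in> carrier G. \<mu> x = c x / (k * N))"
  proof
    assume form': "\<forall>x \<in> carrier G. \<mu> x = c x / (k * N)"
    have "(\<Sum>x\<in>carrier G. \<mu> x) = (\<Sum>x\<in>carrier G. c x) / (k * N)"
      using form' by (simp add: sum_divide_distrib)
    then have "(\<Sum>x\<in>carrier G. \<mu> x) = 1"
      using kN k N by simp
    moreover have "(\<Sum>x\<in>centralizer G y. \<mu> x / c x) = \<mu> y" if "y \<in> carrier G" for y
    proof -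
      have "(\<Sum>x\<in>centralizer G y. \<mu> x / c x) = (\<Sum>x\<in>centralizer G y. 1 / (k * N))"
        using form' cent_sub[of y] cpos by (intro sum.cong) force+
      then show ?thesis
        using form' that by (simp add: c_def)
    qed
    ultimately show "stationary_distribution (carrier G) (commuting_chain G) \<mu>"
      unfolding stationary_distribution_def push
      using form' cpos k N by (auto intro!: divide_nonneg_pos simp: less_imp_le)
  next
    assume st: "stationary_distribution (carrier G) (commuting_chain G) \<mu>"
    define f where "f x = \<mu> x / c x" for x
    have harm: "(\<Sum>x\<in>centralizer G y. f x) = c y * f y" if "y \<in> carrier G" for y
      using st that cpos[OF that] unfolding stationary_distribution_def push f_def by simp
    define M where "M = Max (f ` carrier G)"
    have le: "f x \<le> M" if "x \<in> carrier G" for x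
      unfolding M_def using that fin by simp
    have "M \<in> f ` carrier G"
      unfolding M_def using fin by (intro Max_in) auto
    then obtain m where m: "m \<in> carrier G" "f m = M"
      by auto
    have spread: "f x = M" if "y \<in> carrier G" "f y = M" "x \<in> centralizer G y" for x y
    proof -
      have "(\<Sum>x\<in>centralizer G y. M - f x) = 0"
        using harm[OF that(1)] that(2) by (simp add: sum_subtractf c_def)
      moreover have le': "f z \<le> M" if "z \<in> centralizer G y" for z
        using that le cent_sub by blast
      ultimately have "\<forall>z\<in>centralizer G y. M - f z = 0"
        using sum_nonneg_eq_0_iff[of "centralizer G y" "\<lambda>z. M - f z"]
          finite_subset[OF cent_sub fin] by simp
      then show ?thesis
        using that(3) by simp
    qed
    have "f \<one> = M"
      using spread[OF m] m(1) by (simp add: centralizer_def)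
    then have fM: "f x = M" if "x \<in> carrier G" for x
      using spread[of \<one> x] that by (simp add: centralizer_def)
    have mu: "\<mu> x = M * c x" if "x \<in> carrier G" for x
      using fM[OF that] cpos[OF that] by (auto simp: f_def field_simps)
    have "(\<Sum>x\<in>carrier G. \<mu> x) = M * (k * N)"
      using kN mu by (simp flip: sum_distrib_left)
    then have "M * (k * N) = 1"
      using st by (simp add: stationary_distribution_def)
    then have "M = 1 / (k * N)"
      using k N by (simp add: field_simps)
    then show "\<forall>x \<in> carrier G. \<mu> x = c x / (k * N)"
      using mu by simp
  qed
  then show ?thesis
    using form unfolding k_def w_def by auto
qed

end

end

theory Submission
  imports Defs "HOL-Library.Indicator_Function"
begin

text \<open>Let \<open>p\<close> be the ratio of the order of the centre to the largest order of a non-central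
  centralizer. From every state, two steps of the chain dominate \<open>p / 2\<close> times the uniform
  distribution on the centre, so by Doeblin's argument the distance to stationarity falls below
  \<open>1 / 2\<close> within \<open>5 / p\<close> steps. Conversely, the chain leaves \<open>B\<close>, the largest centralizer without
  the centre, only with probability \<open>p\<close>, and \<open>B\<close> carries at most half of the stationary mass;
  testing with the centred indicator of \<open>B\<close> bounds the distance from below by
  \<open>exp (- 12 * p * t) / 2\<close> for even \<open>t\<close>. Hence, for a small absolute constant \<open>\<epsilon>\<close>, the mixing time
  at \<open>\<epsilon>\<close> is always at least twice the one at \<open>1 - \<epsilon>\<close>.\<close>

section \<open>Finite reversible chains: transition operator, weighted inner product, monotone
  distance\<close>

locale finite_reversible_chain =
  fixes S :: "'a set" and P :: "'a \<Rightarrow> 'a \<Rightarrow> real" and \<pi> :: "'a \<Rightarrow> real"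
  assumes fin: "finite S"
    and nonempty: "S \<noteq> {}"
    and P_nonneg: "\<And>x y. x \<in> S \<Longrightarrow> y \<in> S \<Longrightarrow> 0 \<le> P x y"
    and P_sum: "\<And>x. x \<in> S \<Longrightarrow> (\<Sum>y\<in>S. P x y) = 1"
    and detailed_balance: "\<And>x y. x \<in> S \<Longrightarrow> y \<in> S \<Longrightarrow> \<pi> x * P x y = \<pi> y * P y x"
    and \<pi>_nonneg: "\<And>x. x \<in> S \<Longrightarrow> 0 \<le> \<pi> x"
    and \<pi>_sum: "(\<Sum>x\<in>S. \<pi> x) = 1"
begin

definition markov_op :: "('a \<Rightarrow> real) \<Rightarrow> 'a \<Rightarrow> real"
  where "markov_op f x = (\<Sum>y\<in>S. P x y * f y)"

definition weighted_inner :: "('a \<Rightarrow> real) \<Rightarrow> ('a \<Rightarrow> real) \<Rightarrow> real"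
  where "weighted_inner f g = (\<Sum>x\<in>S. \<pi> x * f x * g x)"

text \<open>The chain is studied through its action on functions: for \<open>A\<close> inside
  \<open>S\<close> and \<open>x\<close> in \<open>S\<close>, this is the probability that the chain
  started at \<open>x\<close> lies in \<open>A\<close> at time \<open>t\<close>.\<close>

abbreviation hit :: "'a set \<Rightarrow> nat \<Rightarrow> 'a \<Rightarrow> real"
  where "hit A t \<equiv> (markov_op ^^ t) (indicator A)"

abbreviation d :: "nat \<Rightarrow> real"
  where "d \<equiv> dist_to_stationary S P \<pi>"

text \<open>\<open>step_prob\<close> appends its steps at the end, so the last step is absorbed into
  the test function; hence \<open>f\<close> must vary in the induction.\<close>

lemma step_prob_sum:
  assumes "x \<in> S"
  shows "(\<Sum>y\<in>S. step_prob S P t x y * f y) = (markov_op ^^ t) f x"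
proof (induction t arbitrary: f)
  case 0
  have "(\<Sum>y\<in>S. step_prob S P 0 x y * f y) = (\<Sum>y\<in>S. if x = y then f y else 0)"
    by (intro sum.cong) auto
  then show ?case
    using assms fin by simp
next
  case (Suc t)
  have "(\<Sum>y\<in>S. step_prob S P (Suc t) x y * f y) =
      (\<Sum>y\<in>S. \<Sum>z\<in>S. step_prob S P t x z * (P z y * f y))"
    by (simp add: sum_distrib_right mult.assoc)
  also have "\<dots> = (\<Sum>z\<in>S. step_prob S P t x z * markov_op f z)"
    by (subst sum.swap) (simp add: markov_op_def sum_distrib_left)
  also have "\<dots> = (markov_op ^^ Suc t) f x"
    by (simp add: Suc funpow_swap1)
  finally show ?case .
qed

lemma step_prob_hit:
  assumes "x \<in> S" "A \<subseteq> S"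
  shows "(\<Sum>y\<in>A. step_prob S P t x y) = hit A t x"
proof -
  have "(\<Sum>y\<in>A. step_prob S P t x y) = (\<Sum>y\<in>S. step_prob S P t x y * indicator A y)"
    using assms fin by (intro sum.mono_neutral_cong_left) (auto simp: indicator_def)
  then show ?thesis
    using step_prob_sum[OF assms(1)] by simp
qed

text \<open>Together with \<open>dist_to_stationary_leI\<close> this describes \<open>d t\<close> as
  the least uniform bound on the deviations of \<open>hit A t\<close>, so later arguments work with
  single events instead of suprema.\<close>

lemma hit_dist_le:
  assumes "x \<in> S" "A \<subseteq> S"
  shows "\<bar>hit A t x - sum \<pi> A\<bar> \<le> d t"
proof -
  let ?g = "\<lambda>A. \<bar>(\<Sum>y\<in>A. step_prob S P t x y) - sum \<pi> A\<bar>"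
  have "?g A \<le> tv_dist S (step_prob S P t x) \<pi>"
    unfolding tv_dist_def using assms fin by (intro cSUP_upper bdd_above_finite) auto
  also have "\<dots> \<le> d t"
    unfolding dist_to_stationary_def using assms fin by simp
  finally show ?thesis
    using step_prob_hit[OF assms] by simp
qed

lemma dist_to_stationary_leI:
  assumes "\<And>x A. x \<in> S \<Longrightarrow> A \<subseteq> S \<Longrightarrow> \<bar>hit A t x - sum \<pi> A\<bar> \<le> b"
  shows "d t \<le> b"
proof -
  have "tv_dist S (step_prob S P t x) \<pi> \<le> b" if "x \<in> S" for x
    unfolding tv_dist_def
    using assms[OF that] by (intro cSUP_least) (auto simp: step_prob_hit[OF that])
  then show ?thesis
    unfolding dist_to_stationary_def using fin nonempty by simp
qed

lemma markov_op_diff_const: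
  assumes "x \<in> S"
  shows "markov_op (\<lambda>y. f y - a) x = markov_op f x - a"
  using P_sum[OF assms]
  by (simp add: markov_op_def right_diff_distrib sum_subtractf flip: sum_distrib_right)

lemma markov_op_cong:
  assumes "\<And>y. y \<in> S \<Longrightarrow> f y = g y"
  shows "markov_op f = markov_op g"
  using assms by (auto simp: markov_op_def)

lemma funpow_markov_op_diff_const:
  assumes "x \<in> S"
  shows "(markov_op ^^ t) (\<lambda>y. f y - a) x = (markov_op ^^ t) f x - a"
  using assms
proof (induction t arbitrary: x)
  case (Suc t)
  \<comment> \<open>The induction hypothesis is an equality on \<open>S\<close> only;
    \<open>markov_op\<close> reads its argument only there, so one more step gives an equality of
    functions.\<close>
  then have "markov_op ((markov_op ^^ t) (\<lambda>y. f y - a)) = markov_op (\<lambda>y. (markov_op ^^ t) f y - a)"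
    by (intro markov_op_cong)
  then show ?case
    using Suc.prems by (simp add: markov_op_diff_const)
qed simp

text \<open>Detailed balance turns the weight at \<open>x\<close> into the weight at
  \<open>y\<close>; exchanging the two sums then puts the operator on the other factor.\<close>

lemma weighted_inner_markov_op:
  "weighted_inner (markov_op f) g = weighted_inner f (markov_op g)"
proof -
  have "weighted_inner (markov_op f) g = (\<Sum>x\<in>S. \<Sum>y\<in>S. (\<pi> x * P x y) * f y * g x)"
    by (simp add: weighted_inner_def markov_op_def sum_distrib_left sum_distrib_right mult_ac)
  also have "\<dots> = (\<Sum>x\<in>S. \<Sum>y\<in>S. (\<pi> y * P y x) * f y * g x)"
    by (intro sum.cong refl) (simp add: detailed_balance)
  also have "\<dots> = weighted_inner f (markov_op g)"
    by (subst sum.swap)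
      (simp add: weighted_inner_def markov_op_def sum_distrib_left sum_distrib_right mult_ac)
  finally show ?thesis .
qed

lemma weighted_inner_funpow:
  "weighted_inner ((markov_op ^^ s) f) g = weighted_inner f ((markov_op ^^ s) g)"
  by (induction s arbitrary: g) (simp_all add: weighted_inner_markov_op flip: funpow_swap1)

text \<open>Self-adjointness, paired with the constant function 1, which the operator fixes on
  \<open>S\<close>.\<close>

lemma stationary_funpow: "(\<Sum>x\<in>S. \<pi> x * (markov_op ^^ t) f x) = (\<Sum>x\<in>S. \<pi> x * f x)"
proof -
  have "(markov_op ^^ t) (\<lambda>_. 1) x = 1" if "x \<in> S" for x
    using that
  proof (induction t arbitrary: x)
    case (Suc t)
    then show ?case
      using P_sum by (simp add: markov_op_def)
  qed simp
  then show ?thesis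
    using weighted_inner_funpow[of t "\<lambda>_. 1" f] by (simp add: weighted_inner_def)
qed

text \<open>Lagrange's identity: the double sum of squares below equals twice the difference of the
  two sides.\<close>

lemma weighted_Cauchy_Schwarz:
  "(weighted_inner f g)\<^sup>2 \<le> weighted_inner f f * weighted_inner g g"
proof -
  have product: "(\<Sum>x\<in>S. \<Sum>y\<in>S. u x * v y) = sum u S * sum v S" for u v :: "'a \<Rightarrow> real"
    by (simp add: sum_product)
  have "0 \<le> (\<Sum>x\<in>S. \<Sum>y\<in>S. \<pi> x * \<pi> y * (f x * g y - f y * g x)\<^sup>2)"
    by (intro sum_nonneg) (simp add: \<pi>_nonneg)
  also have "\<dots> = (\<Sum>x\<in>S. \<Sum>y\<in>S. (\<pi> x * f x * f x) * (\<pi> y * g y * g y))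
      + (\<Sum>x\<in>S. \<Sum>y\<in>S. (\<pi> x * g x * g x) * (\<pi> y * f y * f y))
      - 2 * (\<Sum>x\<in>S. \<Sum>y\<in>S. (\<pi> x * f x * g x) * (\<pi> y * f y * g y))"
    unfolding sum_distrib_left sum.distrib[symmetric] sum_subtractf[symmetric]
    by (intro sum.cong refl) (simp add: power2_eq_square algebra_simps)
  also have "\<dots> = 2 * (weighted_inner f f * weighted_inner g g - (weighted_inner f g)\<^sup>2)"
    unfolding product weighted_inner_def by (simp add: power2_eq_square)
  finally show ?thesis
    by simp
qed

text \<open>Conditioning on the first step makes a deviation at time \<open>Suc t\<close> an average
  of deviations at time \<open>t\<close>.\<close>

lemma dist_to_stationary_Suc_le: "d (Suc t) \<le> d t"
proof (rule dist_to_stationary_leI)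
  fix x A
  assume x: "x \<in> S" and A: "A \<subseteq> S"
  have "hit A (Suc t) x - sum \<pi> A = (\<Sum>y\<in>S. P x y * (hit A t y - sum \<pi> A))"
    using markov_op_diff_const[OF x, of "hit A t" "sum \<pi> A"] by (simp add: markov_op_def)
  also have "\<bar>\<dots>\<bar> \<le> (\<Sum>y\<in>S. \<bar>P x y * (hit A t y - sum \<pi> A)\<bar>)"
    by (rule sum_abs)
  also have "\<dots> \<le> (\<Sum>y\<in>S. P x y * d t)"
    using hit_dist_le[OF _ A] P_nonneg[OF x] by (intro sum_mono) (simp add: abs_mult mult_left_mono)
  also have "\<dots> = d t"
    using P_sum[OF x] by (simp flip: sum_distrib_right)
  finally show "\<bar>hit A (Suc t) x - sum \<pi> A\<bar> \<le> d t" .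
qed

lemma dist_to_stationary_antimono: "s \<le> t \<Longrightarrow> d t \<le> d s"
  by (rule lift_Suc_antimono_le[of d]) (rule dist_to_stationary_Suc_le)

section \<open>Distance bounds: Doeblin contraction from above, Rayleigh quotients from
  below\<close>

lemma two_step_apply:
  assumes "x \<in> S"
  shows "markov_op (markov_op f) x = (\<Sum>z\<in>S. step_prob S P 2 x z * f z)"
  using step_prob_sum[OF assms, of 2 f] by (simp add: numeral_2_eq_2)

text \<open>The part \<open>m\<close> common to all two-step laws cancels in the difference. The
  remainders \<open>R u\<close> are nonnegative with the same mass \<open>1 - sum m S\<close>, and
  they average values lying in an interval of length \<open>D\<close>.\<close>

lemma two_step_oscillation:
  assumes minor: "\<And>x z. x \<in> S \<Longrightarrow> z \<in> S \<Longrightarrow> m z \<le> step_prob S P 2 x z"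
    and osc: "\<And>x y. x \<in> S \<Longrightarrow> y \<in> S \<Longrightarrow> f x - f y \<le> D"
    and "x \<in> S" "y \<in> S"
  shows "markov_op (markov_op f) x - markov_op (markov_op f) y \<le> (1 - sum m S) * D"
proof -
  define R where "R u z = step_prob S P 2 u z - m z" for u z
  have R_nonneg: "0 \<le> R u z" if "u \<in> S" "z \<in> S" for u z
    using minor that by (simp add: R_def)
  have R_sum: "(\<Sum>z\<in>S. R u z) = 1 - sum m S" if "u \<in> S" for u
  proof -
    have "(\<Sum>z\<in>S. step_prob S P 2 u z) = 1"
      using two_step_apply[OF that, of "\<lambda>_. 1"] P_sum that by (simp add: markov_op_def)
    then show ?thesis
      by (simp add: R_def sum_subtractf)
  qed
  have R_apply: "(\<Sum>z\<in>S. R u z * f z) = markov_op (markov_op f) u - (\<Sum>z\<in>S. m z * f z)"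
    if "u \<in> S" for u
    by (simp add: R_def left_diff_distrib sum_subtractf two_step_apply[OF that])
  define a where "a = Min (f ` S)"
  have "a \<in> f ` S"
    unfolding a_def using fin nonempty by (intro Min_in) auto
  then have upper: "f z \<le> a + D" if "z \<in> S" for z
    using osc that by fastforce
  have lower: "a \<le> f z" if "z \<in> S" for z
    unfolding a_def using that fin by simp
  have "(\<Sum>z\<in>S. R x z * f z) \<le> (\<Sum>z\<in>S. R x z * (a + D))"
    using upper R_nonneg assms by (intro sum_mono mult_left_mono) auto
  also have "\<dots> = (1 - sum m S) * (a + D)"
    using R_sum[OF \<open>x \<in> S\<close>] by (simp flip: sum_distrib_right)
  finally have x: "(\<Sum>z\<in>S. R x z * f z) \<le> (1 - sum m S) * (a + D)" .
  have "(1 - sum m S) * a = (\<Sum>z\<in>S. R y z * a)"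
    using R_sum[OF \<open>y \<in> S\<close>] by (simp flip: sum_distrib_right)
  also have "\<dots> \<le> (\<Sum>z\<in>S. R y z * f z)"
    using lower R_nonneg assms by (intro sum_mono mult_left_mono) auto
  finally show ?thesis
    using x R_apply[OF \<open>x \<in> S\<close>] R_apply[OF \<open>y \<in> S\<close>] by (simp add: algebra_simps)
qed

text \<open>An indicator has oscillation at most 1, and every two steps contract it by
  \<open>1 - sum m S\<close>. By stationarity the mass of \<open>A\<close> is the mean of
  \<open>hit A (2 * t)\<close>, so each deviation is a mean of such oscillations.\<close>

lemma doeblin_dist_le:
  assumes "\<And>x z. x \<in> S \<Longrightarrow> z \<in> S \<Longrightarrow> m z \<le> step_prob S P 2 x z"
  shows "d (2 * t) \<le> (1 - sum m S) ^ t"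
proof (rule dist_to_stationary_leI)
  fix x A
  assume x: "x \<in> S" and A: "A \<subseteq> S"
  have osc: "hit A (2 * t) u - hit A (2 * t) v \<le> (1 - sum m S) ^ t" if "u \<in> S" "v \<in> S" for u v
    using that
  proof (induction t arbitrary: u v)
    case (Suc t)
    show ?case
      using two_step_oscillation[OF assms Suc.IH Suc.prems] by simp
  qed (simp add: indicator_def)
  have "(\<Sum>y\<in>S. \<pi> y * indicator A y) = sum \<pi> A"
    using A fin by (intro sum.mono_neutral_cong_right) (auto simp: indicator_def)
  then have "sum \<pi> A = (\<Sum>y\<in>S. \<pi> y * hit A (2 * t) y)"
    using stationary_funpow[of "2 * t" "indicator A"] by simp
  moreover have "hit A (2 * t) x = (\<Sum>y\<in>S. \<pi> y * hit A (2 * t) x)"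
    using \<pi>_sum by (simp flip: sum_distrib_right)
  ultimately have "hit A (2 * t) x - sum \<pi> A = (\<Sum>y\<in>S. \<pi> y * (hit A (2 * t) x - hit A (2 * t) y))"
    by (simp add: right_diff_distrib sum_subtractf)
  also have "\<bar>\<dots>\<bar> \<le> (\<Sum>y\<in>S. \<bar>\<pi> y * (hit A (2 * t) x - hit A (2 * t) y)\<bar>)"
    by (rule sum_abs)
  also have "\<dots> \<le> (\<Sum>y\<in>S. \<pi> y * (1 - sum m S) ^ t)"
    using osc x \<pi>_nonneg by (intro sum_mono) (force simp: abs_mult abs_le_iff intro!: mult_left_mono)
  also have "\<dots> = (1 - sum m S) ^ t"
    using \<pi>_sum by (simp flip: sum_distrib_right)
  finally show "\<bar>hit A (2 * t) x - sum \<pi> A\<bar> \<le> (1 - sum m S) ^ t" .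
qed

text \<open>Self-adjointness makes \<open>t \<mapsto> \<parallel>P\<^sup>t f\<parallel>\<close> log-convex, so the decay of \<open>P\<^sup>t f\<close> can never become
  faster than the Rayleigh quotient of \<open>f\<close>; this replaces the variational characterisation of
  the second eigenvalue.\<close>

lemma weighted_norm_decay:
  assumes rayleigh: "\<rho> * weighted_inner f f \<le> weighted_inner f (markov_op f)"
    and \<rho>: "0 < \<rho>" and pos: "0 < weighted_inner f f"
  shows "\<rho> ^ (2 * t) * weighted_inner f f \<le> weighted_inner f ((markov_op ^^ (2 * t)) f)"
proof -
  define b where "b t = weighted_inner ((markov_op ^^ t) f) ((markov_op ^^ t) f)" for t
  have b_eq: "b t = weighted_inner f ((markov_op ^^ (2 * t)) f)" for t
    unfolding b_def weighted_inner_funpow by (simp add: mult_2 funpow_add)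
  have cross: "b (Suc t) = weighted_inner ((markov_op ^^ t) f) ((markov_op ^^ Suc (Suc t)) f)" for t
    unfolding b_def by (simp add: weighted_inner_markov_op)
  \<comment> \<open>By Cauchy-Schwarz and \<open>cross\<close>, the ratio of
    \<open>b (Suc t)\<close> to \<open>b t\<close> never decreases, and the Rayleigh bound controls
    the first ratio. Positivity is carried along to allow cancellation.\<close>
  have step: "0 < b t \<and> \<rho>\<^sup>2 * b t \<le> b (Suc t)" for t
  proof (induction t)
    case 0
    have "(\<rho> * b 0)\<^sup>2 \<le> (weighted_inner f (markov_op f))\<^sup>2"
      using rayleigh \<rho> pos by (intro power_mono) (auto simp: b_def)
    also have "\<dots> \<le> b 0 * b 1"
      using weighted_Cauchy_Schwarz[of f "markov_op f"] by (simp add: b_def)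
    finally have "b 0 * (\<rho>\<^sup>2 * b 0) \<le> b 0 * b 1"
      by (simp add: power2_eq_square mult_ac)
    then show ?case
      using pos by (simp add: b_def)
  next
    case (Suc t)
    then have pos': "0 < b (Suc t)"
      using \<rho> by (smt (verit) zero_less_mult_iff zero_less_power)
    have "b t * (\<rho>\<^sup>2 * b (Suc t)) = (\<rho>\<^sup>2 * b t) * b (Suc t)"
      by simp
    also have "\<dots> \<le> b (Suc t) * b (Suc t)"
      using Suc pos' by (intro mult_right_mono) auto
    also have "\<dots> \<le> b t * b (Suc (Suc t))"
      using weighted_Cauchy_Schwarz[of "(markov_op ^^ t) f" "(markov_op ^^ Suc (Suc t)) f"]
      by (metis b_def cross power2_eq_square)
    finally show ?case
      using Suc pos' by simp
  qed
  have "(\<rho>\<^sup>2) ^ t * b 0 \<le> b t"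
  proof (induction t)
    case (Suc t)
    then have "\<rho>\<^sup>2 * ((\<rho>\<^sup>2) ^ t * b 0) \<le> \<rho>\<^sup>2 * b t"
      by (intro mult_left_mono) auto
    then show ?case
      using step[of t] by (simp add: mult.assoc)
  qed simp
  then show ?thesis
    by (simp add: b_eq power_mult)
qed

text \<open>The centred indicator of \<open>B\<close> has Rayleigh quotient exactly \<rho>. Pairing
  it with its image after \<open>2 * t\<close> steps yields a weighted sum over \<open>B\<close> of
  deviations of \<open>hit B (2 * t)\<close>, each at most \<open>d (2 * t)\<close>.\<close>

lemma dist_lower_bound_of_set:
  assumes B: "B \<subseteq> S" and pos: "0 < sum \<pi> B" and less: "sum \<pi> B < 1"
    and stay: "\<And>x. x \<in> B \<Longrightarrow> (\<Sum>y\<in>B. P x y) = 1 - q"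
    and \<rho>: "\<rho> = 1 - q / (1 - sum \<pi> B)" "0 < \<rho>"
  shows "(1 - sum \<pi> B) * \<rho> ^ (2 * t) \<le> d (2 * t)"
proof -
  define b where "b = sum \<pi> B"
  define f where "f x = indicator B x - b" for x
  have sum_B: "(\<Sum>x\<in>S. \<pi> x * indicator B x * g x) = (\<Sum>x\<in>B. \<pi> x * g x)" for g
    using B fin by (intro sum.mono_neutral_cong_right) (auto simp: indicator_def)
  have mean_f: "(\<Sum>x\<in>S. \<pi> x * f x) = 0"
    using sum_B[of "\<lambda>_. 1"] \<pi>_sum
    by (simp add: f_def right_diff_distrib sum_subtractf b_def flip: sum_distrib_right)
  \<comment> \<open>The constant \<open>b\<close> in the left factor contributes nothing, because
    the mean of \<open>f\<close> is zero and is preserved by the chain.\<close>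
  have inner: "weighted_inner f ((markov_op ^^ s) f) = (\<Sum>x\<in>B. \<pi> x * (hit B s x - b))" for s
  proof -
    have "weighted_inner f ((markov_op ^^ s) f) =
        (\<Sum>x\<in>S. \<pi> x * indicator B x * (markov_op ^^ s) f x) - b * (\<Sum>x\<in>S. \<pi> x * (markov_op ^^ s) f x)"
      unfolding weighted_inner_def sum_distrib_left sum_subtractf[symmetric]
      by (intro sum.cong refl) (simp add: f_def algebra_simps)
    also have "\<dots> = (\<Sum>x\<in>B. \<pi> x * (markov_op ^^ s) f x)"
      by (simp add: sum_B stationary_funpow mean_f)
    also have "\<dots> = (\<Sum>x\<in>B. \<pi> x * (hit B s x - b))"
      using B by (intro sum.cong refl) (auto simp: f_def[abs_def] funpow_markov_op_diff_const)
    finally show ?thesis .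
  qed
  have f_f: "weighted_inner f f = b * (1 - b)"
    using inner[of 0] by (simp add: b_def flip: sum_distrib_right)
  have hit_1: "hit B 1 x = 1 - q" if "x \<in> B" for x
  proof -
    have "hit B 1 x = (\<Sum>y\<in>B. P x y)"
      unfolding markov_op_def using B fin
      by (simp add: markov_op_def, intro sum.mono_neutral_cong_right) (auto simp: indicator_def)
    then show ?thesis
      using stay that by simp
  qed
  have "weighted_inner f (markov_op f) = b * (1 - q - b)"
    using inner[of 1] hit_1 by (simp add: b_def flip: sum_distrib_right)
  also have "\<dots> = \<rho> * weighted_inner f f"
    using less by (simp add: f_f \<rho>(1) b_def field_simps)
  finally have "\<rho> ^ (2 * t) * weighted_inner f f \<le> weighted_inner f ((markov_op ^^ (2 * t)) f)"
    using \<rho>(2) pos less by (intro weighted_norm_decay) (auto simp: f_f b_def)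
  also have "\<dots> \<le> (\<Sum>x\<in>B. \<pi> x * d (2 * t))"
    unfolding inner b_def
    using hit_dist_le[OF _ B] B \<pi>_nonneg by (intro sum_mono mult_left_mono) (auto simp: abs_le_iff)
  also have "\<dots> = b * d (2 * t)"
    by (simp add: b_def flip: sum_distrib_right)
  finally have "b * ((1 - b) * \<rho> ^ (2 * t)) \<le> b * d (2 * t)"
    by (simp add: f_f mult_ac)
  then show ?thesis
    using pos by (simp add: b_def)
qed

end

section \<open>Orders of centralizers and of the center\<close>

context group
begin

text \<open>For \<open>k\<close> in \<open>K\<close> outside \<open>H\<close>, the coset of
  \<open>k\<close> is a second copy of \<open>H\<close> inside \<open>K\<close>, disjoint from
  \<open>H\<close>.\<close>

lemma two_card_proper_subgroup_le:
  assumes H: "subgroup H G" and K: "subgroup K G" and "H \<subset> K" "finite K"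
  shows "2 * card H \<le> card K"
proof -
  obtain k where k: "k \<in> K" "k \<notin> H"
    using \<open>H \<subset> K\<close> by auto
  have HG: "H \<subseteq> carrier G" and KG: "K \<subseteq> carrier G"
    using H K subgroup.subset by auto
  have inj: "inj_on (\<lambda>h. k \<otimes> h) H"
    using k(1) HG KG by (intro inj_onI) (auto simp: subset_iff)
  have "k \<otimes> h \<notin> H" if "h \<in> H" for h
  proof
    assume "k \<otimes> h \<in> H"
    then have "k \<otimes> h \<otimes> inv h \<in> H"
      using H that by (simp add: subgroup.m_closed subgroup.m_inv_closed)
    moreover have "k \<otimes> h \<otimes> inv h = k"
      using k(1) HG KG that by (simp add: m_assoc subset_iff)
    ultimately show False
      using k by simp
  qed
  then have "H \<inter> (\<lambda>h. k \<otimes> h) ` H = {}"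
    by auto
  moreover have "H \<union> (\<lambda>h. k \<otimes> h) ` H \<subseteq> K"
    using k K \<open>H \<subset> K\<close> by (auto simp: subgroup.m_closed)
  moreover have "finite H"
    using \<open>H \<subset> K\<close> \<open>finite K\<close> finite_subset by auto
  ultimately show ?thesis
    using card_mono[OF \<open>finite K\<close>, of "H \<union> (\<lambda>h. k \<otimes> h) ` H"]
    by (simp add: card_Un_disjoint card_image[OF inj])
qed

lemma centralizer_subgroup:
  assumes x: "x \<in> carrier G"
  shows "subgroup (centralizer G x) G"
  using group_action.stabilizer_subgroup[OF action_by_conjugation x] centralizer_eq_stabilizer[OF x]
  by (simp add: conjugation_def)

lemma center_eq_Inter_centralizer: "center G = (\<Inter>x\<in>carrier G. centralizer G x)"
  by (auto simp: center_def centralizer_def)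

lemma center_subgroup: "subgroup (center G) G"
  unfolding center_eq_Inter_centralizer
  by (rule subgroups_Inter) (auto intro: centralizer_subgroup)

lemma centralizer_subset_carrier: "centralizer G x \<subseteq> carrier G"
  by (auto simp: centralizer_def)

lemma center_subset_centralizer: "x \<in> carrier G \<Longrightarrow> center G \<subseteq> centralizer G x"
  by (auto simp: center_def centralizer_def)

lemma centralizer_of_center: "x \<in> center G \<Longrightarrow> centralizer G x = carrier G"
  by (auto simp: center_def centralizer_def)

lemma mem_centralizer_self: "x \<in> carrier G \<Longrightarrow> x \<in> centralizer G x"
  by (simp add: centralizer_def)

lemma two_card_center_le:
  assumes fin: "finite (carrier G)" and x: "x \<in> carrier G - center G"
  shows "2 * card (center G) \<le> card (centralizer G x)"
proof (rule two_card_proper_subgroup_le[OF center_subgroup])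
  show "subgroup (centralizer G x) G"
    using x by (simp add: centralizer_subgroup)
  show "center G \<subset> centralizer G x"
    using x center_subset_centralizer mem_centralizer_self by blast
  show "finite (centralizer G x)"
    using fin centralizer_subset_carrier finite_subset by blast
qed

lemma two_card_centralizer_le:
  assumes fin: "finite (carrier G)" and x: "x \<in> carrier G - center G"
  shows "2 * card (centralizer G x) \<le> card (carrier G)"
proof (rule two_card_proper_subgroup_le)
  show "subgroup (centralizer G x) G" "subgroup (carrier G) G"
    using x by (auto simp: centralizer_subgroup subgroup_self)
  obtain y where y: "y \<in> carrier G" "x \<otimes> y \<noteq> y \<otimes> x"
    using x by (auto simp: center_def)
  then have "y \<notin> centralizer G x"
    by (auto simp: centralizer_def)
  then show "centralizer G x \<subset> carrier G"
    using centralizer_subset_carrier y by blast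
qed (use fin in simp)

text \<open>Transitivity gives both inclusions; central elements, to which it does not apply, lie in
  every centralizer. Thus the non-central parts of these centralizers are disjoint or equal.\<close>

lemma CA_centralizer_eq:
  assumes CA: "CA_group G" and x: "x \<in> carrier G - center G"
    and y: "y \<in> centralizer G x - center G"
  shows "centralizer G y = centralizer G x"
proof -
  have sub: "centralizer G a \<subseteq> centralizer G b"
    if a: "a \<in> carrier G - center G" and b: "b \<in> carrier G - center G" and "a \<otimes> b = b \<otimes> a" for a b
  proof
    fix h
    assume h: "h \<in> centralizer G a"
    show "h \<in> centralizer G b"
    proof (cases "h \<in> center G")
      case True
      then show ?thesis
        using b center_subset_centralizer by blast
    next
      case False
      then show ?thesis
        using h a b \<open>a \<otimes> b = b \<otimes> a\<close> CA unfolding CA_group_def centralizer_def by blast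
    qed
  qed
  have "y \<in> carrier G - center G" "y \<otimes> x = x \<otimes> y"
    using y by (auto simp: centralizer_def)
  then show ?thesis
    using sub[of x y] sub[of y x] x by auto
qed

section \<open>The commuting chain: reversibility, distance bounds and mixing times\<close>

lemma commuting_chain_sum:
  assumes fin: "finite (carrier G)" and "A \<subseteq> carrier G" "x \<in> carrier G"
  shows "(\<Sum>y\<in>A. commuting_chain G x y * f y) =
    (\<Sum>y\<in>A \<inter> centralizer G x. f y) / card (centralizer G x)"
proof -
  have "(\<Sum>y\<in>A. commuting_chain G x y * f y) =
      (\<Sum>y\<in>A \<inter> centralizer G x. f y / card (centralizer G x))"
    using assms finite_subset[OF assms(2) fin]
    by (intro sum.mono_neutral_cong_right) (auto simp: commuting_chain_def centralizer_def)
  then show ?thesis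
    by (simp add: sum_divide_distrib)
qed

lemma card_centralizer_pos:
  assumes "finite (carrier G)" "x \<in> carrier G"
  shows "0 < card (centralizer G x)"
  using assms mem_centralizer_self[of x] finite_subset[OF centralizer_subset_carrier]
  by (auto simp: card_gt_0_iff)

text \<open>By orbit-stabilizer, the reciprocal class size is proportional to the order of the
  centralizer.\<close>

lemma stationary_distribution_eq_card_centralizer:
  assumes fin: "finite (carrier G)"
    and st: "stationary_distribution (carrier G) (commuting_chain G) \<pi>"
  obtains \<alpha> :: real where "0 < \<alpha>" "\<And>x. x \<in> carrier G \<Longrightarrow> \<pi> x = \<alpha> * card (centralizer G x)"
proof -
  define k where "k = real (card (orbits G (carrier G) (conjugation G)))"
  define N where "N = real (card (carrier G))"
  have N: "0 < N"
    unfolding N_def using fin by (auto simp: card_gt_0_iff)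
  have eq: "\<pi> x = 1 / (k * N) * card (centralizer G x)" if x: "x \<in> carrier G" for x
  proof -
    have "\<pi> x = 1 / (k * card (orbit G (conjugation G) x))"
      using st x unfolding stationary_distribution_commuting_chain_iff[OF fin] k_def by simp
    moreover have "N = card (orbit G (conjugation G) x) * card (centralizer G x)"
      unfolding N_def using class_times_centralizer[OF x] by simp
    ultimately show ?thesis
      using N card_centralizer_pos[OF fin x] by (simp add: field_simps)
  qed
  \<comment> \<open>Division by zero being zero, \<open>k = 0\<close> would make the whole
    distribution vanish, against total mass 1.\<close>
  have "k \<noteq> 0"
  proof
    assume "k = 0"
    then have "(\<Sum>x\<in>carrier G. \<pi> x) = 0"
      using eq by (intro sum.neutral) simp
    then show False
      using st by (simp add: stationary_distribution_def)
  qed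
  then have "0 < 1 / (k * N)"
    using N by (simp add: k_def)
  then show thesis
    using that eq by blast
qed

text \<open>Detailed balance holds because both sides equal \<alpha> on commuting pairs and 0 on all
  others.\<close>

lemma finite_reversible_commuting_chain:
  assumes fin: "finite (carrier G)"
    and st: "stationary_distribution (carrier G) (commuting_chain G) \<pi>"
  shows "finite_reversible_chain (carrier G) (commuting_chain G) \<pi>"
proof
  obtain \<alpha> :: real where \<alpha>: "0 < \<alpha>" "\<And>x. x \<in> carrier G \<Longrightarrow> \<pi> x = \<alpha> * card (centralizer G x)"
    using stationary_distribution_eq_card_centralizer[OF fin st] by blast
  show "(\<Sum>y\<in>carrier G. commuting_chain G x y) = 1" if "x \<in> carrier G" for x
    using commuting_chain_sum[OF fin order_refl that, of "\<lambda>_. 1"] card_centralizer_pos[OF fin that]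
      centralizer_subset_carrier by (simp add: Int_absorb1)
  show "\<pi> x * commuting_chain G x y = \<pi> y * commuting_chain G y x"
    if "x \<in> carrier G" "y \<in> carrier G" for x y
    using that \<alpha> card_centralizer_pos[OF fin that(1)] card_centralizer_pos[OF fin that(2)]
    by (auto simp: commuting_chain_def)
  show "\<And>x. x \<in> carrier G \<Longrightarrow> 0 \<le> \<pi> x" "(\<Sum>x\<in>carrier G. \<pi> x) = 1"
    using st by (auto simp: stationary_distribution_def)
qed (use fin in \<open>auto simp: commuting_chain_def\<close>)

text \<open>The first step avoids the center with probability at least 1/2; from a non-central
  element the second step hits \<open>w\<close> with probability at least \<open>1 / c\<close>. A
  single step from a central \<open>x\<close> would only give the reciprocal of the group
  order.\<close>

lemma commuting_chain_minorization:
  assumes fin: "finite (carrier G)"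
    and max: "\<And>y. y \<in> carrier G - center G \<Longrightarrow> card (centralizer G y) \<le> c"
    and nonabelian: "center G \<noteq> carrier G" and x: "x \<in> carrier G" and w: "w \<in> center G"
  shows "1 / (2 * real c) \<le> step_prob (carrier G) (commuting_chain G) 2 x w"
proof -
  have wG: "w \<in> carrier G"
    using w by (simp add: center_def)
  obtain g where g: "g \<in> carrier G - center G"
    using nonabelian by (auto simp: center_def)
  have finC: "finite (centralizer G x)"
    using fin centralizer_subset_carrier finite_subset by blast
  \<comment> \<open>For central \<open>x\<close> the centralizer is the whole group, so the bound
    passes through the centralizer of the non-central \<open>g\<close>.\<close>
  have half: "2 * card (center G) \<le> card (centralizer G x)"
  proof (cases "x \<in> center G")
    case True
    then show ?thesis
      using two_card_center_le[OF fin g] two_card_centralizer_le[OF fin g]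
      by (simp add: centralizer_of_center)
  next
    case False
    then show ?thesis
      using two_card_center_le[OF fin] x by simp
  qed
  have "card (centralizer G x - center G) = card (centralizer G x) - card (center G)"
    using center_subset_centralizer[OF x] finC finite_subset by (intro card_Diff_subset) auto
  then have half': "real (card (centralizer G x)) \<le> 2 * card (centralizer G x - center G)"
    using half by linarith
  have c: "0 < c"
    using max[OF g] card_centralizer_pos[OF fin] g by fastforce
  have P_w: "commuting_chain G y w = 1 / card (centralizer G y)" if "y \<in> carrier G" for y
    using w that by (simp add: commuting_chain_def center_def)
  have "step_prob (carrier G) (commuting_chain G) 2 x w =
      (\<Sum>y\<in>carrier G. commuting_chain G x y * commuting_chain G y w)"
  proof -
    have "(\<Sum>z\<in>carrier G. (if x = z then 1 else 0) * commuting_chain G z y) = commuting_chain G x y"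
      for y
    proof -
      have "(\<Sum>z\<in>carrier G. (if x = z then 1 else 0) * commuting_chain G z y) =
          (\<Sum>z\<in>carrier G. if x = z then commuting_chain G z y else 0)"
        by (intro sum.cong) auto
      then show ?thesis
        using x fin by simp
    qed
    then show ?thesis
      by (simp add: numeral_2_eq_2)
  qed
  also have "\<dots> = (\<Sum>y\<in>centralizer G x. commuting_chain G y w) / card (centralizer G x)"
    using commuting_chain_sum[OF fin order_refl x] centralizer_subset_carrier
    by (simp add: Int_absorb1)
  finally have P2: "step_prob (carrier G) (commuting_chain G) 2 x w =
      (\<Sum>y\<in>centralizer G x. commuting_chain G y w) / card (centralizer G x)" .
  have "card (centralizer G x - center G) / real c \<le>
      (\<Sum>y\<in>centralizer G x - center G. commuting_chain G y w)"
  proof -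
    have "1 / real c \<le> commuting_chain G y w" if "y \<in> centralizer G x - center G" for y
    proof -
      have y: "y \<in> carrier G - center G"
        using that centralizer_subset_carrier by blast
      then have "0 < card (centralizer G y)"
        using card_centralizer_pos[OF fin] by blast
      then show ?thesis
        using P_w[of y] max[OF y] y by (simp add: frac_le)
    qed
    then show ?thesis
      using sum_bounded_below[of "centralizer G x - center G" "1 / real c"] by simp
  qed
  also have "\<dots> \<le> (\<Sum>y\<in>centralizer G x. commuting_chain G y w)"
    using finC by (intro sum_mono2) (auto simp: commuting_chain_def)
  finally have "real (card (centralizer G x)) / (2 * real c) \<le>
      (\<Sum>y\<in>centralizer G x. commuting_chain G y w)"
    using half' c by (simp add: field_simps)
  then show ?thesis
    unfolding P2 using card_centralizer_pos[OF fin x] by (simp add: field_simps)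
qed

lemma card_centralizer_le_max:
  assumes "finite (carrier G)" "y \<in> carrier G - center G"
  shows "card (centralizer G y) \<le> max_centralizer_card G"
proof -
  have "finite {card (centralizer G x) | x. x \<in> carrier G - center G}"
    using assms by (simp add: setcompr_eq_image)
  then show ?thesis
    unfolding max_centralizer_card_def using assms by (intro Max_ge) auto
qed

text \<open>Doeblin's bound with the constant \<open>1 / (2 * c)\<close> on the center as common
  part.\<close>

lemma commuting_chain_dist_upper:
  assumes fin: "finite (carrier G)" and nonabelian: "center G \<noteq> carrier G"
    and st: "stationary_distribution (carrier G) (commuting_chain G) \<pi>"
  shows "dist_to_stationary (carrier G) (commuting_chain G) \<pi> (2 * t) \<le>
    (1 - card (center G) / (2 * max_centralizer_card G)) ^ t"
proof -
  interpret finite_reversible_chain "carrier G" "commuting_chain G" \<pi>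
    by (rule finite_reversible_commuting_chain[OF fin st])
  define c where "c = max_centralizer_card G"
  define m where "m w = (if w \<in> center G then 1 / (2 * real c) else 0)" for w
  have nonneg: "0 \<le> step_prob (carrier G) (commuting_chain G) s x w" for s x w
    by (induction s arbitrary: w) (auto intro!: sum_nonneg simp: commuting_chain_def)
  have "center G \<subseteq> carrier G"
    by (auto simp: center_def)
  then have "sum m (carrier G) = (\<Sum>w\<in>center G. 1 / (2 * real c))"
    using fin by (intro sum.mono_neutral_cong_right) (auto simp: m_def)
  then have "sum m (carrier G) = card (center G) / (2 * real c)"
    by simp
  moreover have "m w \<le> step_prob (carrier G) (commuting_chain G) 2 x w" if "x \<in> carrier G" for x w
    unfolding m_def c_def
    using commuting_chain_minorization[OF fin card_centralizer_le_max[OF fin] nonabelian that] nonneg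
    by simp
  ultimately show ?thesis
    using doeblin_dist_le[of m t] by (simp add: c_def)
qed

text \<open>By the CA property all elements of \<open>B\<close> have the same centralizer
  \<open>A\<close>, so a step from \<open>B\<close> is uniform on \<open>A\<close> and leaves
  \<open>B\<close> exactly by hitting the center, with probability \<open>p\<close>. It remains to
  bound the resulting rate \<rho> below by an exponential in \<open>p\<close>.\<close>

lemma commuting_chain_dist_lower:
  assumes CA: "CA_group G" and fin: "finite (carrier G)" and x0: "x0 \<in> carrier G - center G"
    and st: "stationary_distribution (carrier G) (commuting_chain G) \<pi>"
    and half: "sum \<pi> (centralizer G x0 - center G) \<le> 1 / 2"
  shows "exp (- 12 * (card (center G) / card (centralizer G x0))) ^ (2 * t) / 2 \<le>
    dist_to_stationary (carrier G) (commuting_chain G) \<pi> (2 * t)"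
proof -
  interpret finite_reversible_chain "carrier G" "commuting_chain G" \<pi>
    by (rule finite_reversible_commuting_chain[OF fin st])
  obtain \<alpha> :: real
    where \<alpha>: "0 < \<alpha>" "\<And>x. x \<in> carrier G \<Longrightarrow> \<pi> x = \<alpha> * card (centralizer G x)"
    using stationary_distribution_eq_card_centralizer[OF fin st] by blast
  define A where "A = centralizer G x0"
  define B where "B = A - center G"
  define b where "b = sum \<pi> B"
  have b_half: "b \<le> 1 / 2"
    using half by (simp add: b_def A_def B_def)
  define c z N where "c = real (card A)" and "z = real (card (center G))"
    and "N = real (card (carrier G))"
  define p where "p = z / c"
  have x0': "x0 \<in> carrier G"
    using x0 by simp
  have A: "A \<subseteq> carrier G" "center G \<subseteq> A"
    unfolding A_def using centralizer_subset_carrier center_subset_centralizer[OF x0'] by auto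
  have A_fin: "finite A" "finite (center G)"
    using finite_subset[OF A(1) fin] finite_subset[OF A(2)] by auto
  have B: "B \<subseteq> carrier G"
    using A(1) by (auto simp: B_def)
  have z: "0 < z"
    using subgroup.one_closed[OF center_subgroup] A_fin(2) by (auto simp: z_def card_gt_0_iff)
  have zc: "2 * z \<le> c" and cN: "2 * c \<le> N"
    using two_card_center_le[OF fin x0] two_card_centralizer_le[OF fin x0]
    unfolding z_def c_def A_def N_def by linarith+
  have card_B: "real (card B) = c - z"
    unfolding B_def c_def z_def using A(2) A_fin card_mono[OF A_fin(1) A(2)]
    by (simp add: card_Diff_subset of_nat_diff)
  have cent_B: "centralizer G y = A" if "y \<in> B" for y
    using CA_centralizer_eq[OF CA x0] that by (simp add: A_def B_def)
  have b_eq: "b = \<alpha> * c * (c - z)"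
  proof -
    have "sum \<pi> B = (\<Sum>y\<in>B. \<alpha> * c)"
    proof (rule sum.cong)
      fix y
      assume y: "y \<in> B"
      then have "y \<in> carrier G"
        using B by blast
      then show "\<pi> y = \<alpha> * c"
        using \<alpha>(2) cent_B[OF y] by (simp add: c_def)
    qed simp
    then show ?thesis
      using card_B by (simp add: b_def)
  qed
  have "0 < b"
    using \<alpha>(1) z zc by (simp add: b_eq)
  \<comment> \<open>Outside \<open>A\<close> there are at least \<open>c\<close> elements, each with
    a centralizer of order at least \<open>2 * z\<close>.\<close>
  have "2 * \<alpha> * c * z \<le> 1 - b"
  proof -
    have "real (card (carrier G - A)) = N - c"
      unfolding N_def c_def using A(1) A_fin(1) card_mono[OF fin A(1)]
      by (simp add: card_Diff_subset of_nat_diff)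
    then have "\<alpha> * (2 * z) * c \<le> \<alpha> * (2 * z) * card (carrier G - A)"
      using cN \<alpha>(1) z by (intro mult_left_mono) auto
    also have "\<dots> = (\<Sum>y\<in>carrier G - A. \<alpha> * (2 * z))"
      by simp
    also have "\<dots> \<le> sum \<pi> (carrier G - A)"
    proof (rule sum_mono)
      fix y
      assume "y \<in> carrier G - A"
      then have "y \<in> carrier G - center G"
        using A by blast
      then have "2 * z \<le> card (centralizer G y)"
        unfolding z_def using two_card_center_le[OF fin, of y] by linarith
      then show "\<alpha> * (2 * z) \<le> \<pi> y"
        using \<alpha>(1) \<alpha>(2)[of y] \<open>y \<in> carrier G - A\<close> by simp
    qed
    also have "\<dots> \<le> sum \<pi> (carrier G - B)"
      using fin \<pi>_nonneg by (intro sum_mono2) (auto simp: B_def)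
    also have "\<dots> = 1 - b"
      using sum_diff[OF fin B, of \<pi>] \<pi>_sum by (simp add: b_def)
    finally show ?thesis
      by (simp add: mult_ac)
  qed
  \<comment> \<open>This leads to \<open>gap1\<close>, which keeps \<rho> at least 1/4 up to
    \<open>p = 1 / 2\<close>. The simpler \<open>gap2\<close>, from \<open>b_half\<close>, is
    sharper for small \<open>p\<close> but gives only a rate of 0 at
    \<open>p = 1 / 2\<close>.\<close>
  then have "2 * z * b \<le> (1 - b) * (c - z)"
    using mult_right_mono[of "2 * \<alpha> * c * z" "1 - b" "c - z"] z zc
    by (simp add: b_eq mult_ac)
  then have "2 * z \<le> (1 - b) * (c + z)"
    by (simp add: algebra_simps)
  moreover have p: "0 < p" "p \<le> 1 / 2"
    using z zc by (simp_all add: p_def field_simps)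
  ultimately have "2 * p \<le> (1 - b) * (1 + p)"
    using z zc by (simp add: p_def field_simps)
  then have gap1: "p / (1 - b) \<le> (1 + p) / 2"
    using b_half by (simp add: pos_divide_le_eq mult.commute)
  have "p * 1 \<le> p * (2 * (1 - b))"
    using b_half p by (intro mult_left_mono) auto
  then have gap2: "p / (1 - b) \<le> 2 * p"
    using b_half by (simp add: pos_divide_le_eq mult_ac)
  define \<rho> where "\<rho> = 1 - p / (1 - b)"
  have "exp (12 * p) \<ge> 1 + 12 * p"
    by simp
  then have "exp (- 12 * p) \<le> 1 / (1 + 12 * p)"
    using p by (simp add: exp_minus inverse_eq_divide frac_le)
  \<comment> \<open>Small \<open>p\<close> uses \<open>gap2\<close>, large \<open>p\<close> uses
    \<open>gap1\<close>. The constant 12 makes the left side equal 1/4 at the threshold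
    \<open>p = 1 / 4\<close>.\<close>
  also have "\<dots> \<le> \<rho>"
  proof (cases "p \<le> 1 / 4")
    case True
    have "0 \<le> p * (10 - 24 * p)"
      using True p by (intro mult_nonneg_nonneg) auto
    then have "1 \<le> (1 - 2 * p) * (1 + 12 * p)"
      by (simp add: algebra_simps)
    then have "1 / (1 + 12 * p) \<le> 1 - 2 * p"
      using p by (simp add: field_simps)
    then show ?thesis
      using gap2 by (simp add: \<rho>_def)
  next
    case False
    then have "1 / (1 + 12 * p) \<le> 1 / 4"
      by (intro frac_le) auto
    also have "\<dots> \<le> \<rho>"
      using order_trans[OF gap1, of "3 / 4"] p by (simp add: \<rho>_def)
    finally show ?thesis .
  qed
  finally have \<rho>_ge: "exp (- 12 * p) \<le> \<rho>" .
  have stay: "(\<Sum>y\<in>B. commuting_chain G x y) = 1 - p" if "x \<in> B" for x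
  proof -
    have "(\<Sum>y\<in>B. commuting_chain G x y) = card B / c"
    proof -
      have "x \<in> carrier G" "B \<inter> A = B"
        using that B by (auto simp: B_def)
      then show ?thesis
        using commuting_chain_sum[OF fin B, of x "\<lambda>_. 1"] cent_B[OF that] by (simp add: c_def)
    qed
    also have "\<dots> = 1 - p"
      using z zc by (simp add: card_B p_def diff_divide_distrib)
    finally show ?thesis .
  qed
  have "1 / 2 * exp (- 12 * p) ^ (2 * t) \<le> (1 - b) * \<rho> ^ (2 * t)"
    using b_half power_mono[OF \<rho>_ge, of "2 * t"] by (intro mult_mono) auto
  also have "\<dots> \<le> d (2 * t)"
    using b_half \<open>0 < b\<close> less_le_trans[OF exp_gt_zero \<rho>_ge]
      dist_lower_bound_of_set[OF B _ _ stay \<rho>_def[unfolded b_def]]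
    by (simp add: b_def)
  finally show ?thesis
    by (simp add: p_def z_def c_def A_def)
qed

text \<open>The value \<open>10 / p\<close> separates the two sides: the upper bound gives
  \<open>T (1 - \<epsilon>)\<close> at most \<open>5 / p\<close>, the lower bound gives
  \<open>T \<epsilon>\<close> at least \<open>10 / p\<close>.\<close>

lemma commuting_chain_mixing_time_gap:
  assumes CA: "CA_group G" and fin: "finite (carrier G)" and x0: "x0 \<in> carrier G - center G"
    and max: "card (centralizer G x0) = max_centralizer_card G"
    and st: "stationary_distribution (carrier G) (commuting_chain G) \<pi>"
    and half: "sum \<pi> (centralizer G x0 - center G) \<le> 1 / 2"
  defines "T \<equiv> mixing_time (carrier G) (commuting_chain G) \<pi>"
  shows "2 * T (1 - exp (- 134)) \<le> T (exp (- 134))"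
proof -
  interpret finite_reversible_chain "carrier G" "commuting_chain G" \<pi>
    by (rule finite_reversible_commuting_chain[OF fin st])
  \<comment> \<open>134 is 12 * 11 + 2: the rate 12 over a scaled time of at most 11, and
    \<open>exp 2\<close> to outweigh the factor 1/2 in \<open>lower\<close>.\<close>
  define \<epsilon> :: real where "\<epsilon> = exp (- 134)"
  define c z where "c = real (card (centralizer G x0))" and "z = real (card (center G))"
  define p where "p = z / c"
  have z: "0 < z"
    using subgroup.one_closed[OF center_subgroup] finite_subset[OF _ fin, of "center G"]
    by (auto simp: z_def card_gt_0_iff center_def)
  have zc: "2 * z \<le> c"
    unfolding z_def c_def using two_card_center_le[OF fin x0] by linarith
  then have p: "0 < p" "p \<le> 1 / 2"
    using z by (simp_all add: p_def field_simps)
  have upper: "d (2 * t) \<le> (1 - p / 2) ^ t" for t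
  proof -
    have "center G \<noteq> carrier G"
      using x0 by auto
    then show ?thesis
      using commuting_chain_dist_upper[OF fin _ st, of t]
      by (simp add: p_def z_def c_def max mult.commute)
  qed
  have lower: "exp (- 12 * p) ^ (2 * t) / 2 \<le> d (2 * t)" for t
    using commuting_chain_dist_lower[OF CA fin x0 st half] by (simp add: p_def z_def c_def)
  have \<epsilon>: "0 < \<epsilon>" "2 * \<epsilon> < exp (- 132)"
  proof -
    have "exp (- 132) = exp 2 * \<epsilon>"
      by (simp add: \<epsilon>_def flip: exp_add)
    then show "2 * \<epsilon> < exp (- 132)"
      using exp_ge_add_one_self[of 2] by (simp add: \<epsilon>_def)
  qed (simp add: \<epsilon>_def)
  have "exp (- 132 :: real) \<le> 1"
    by simp
  then have \<epsilon>_le: "\<epsilon> < 1 / 2"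
    using \<epsilon> by linarith
  \<comment> \<open>With at least \<open>2 / p\<close> double steps the upper bound drops to
    \<open>exp (- 1)\<close>, below 1/2.\<close>
  define m where "m = nat \<lceil>2 / p\<rceil>"
  have m: "2 / p \<le> m" "m \<le> 2 / p + 1"
    unfolding m_def using p by (simp_all add: of_nat_ceiling)
  have "d (2 * m) \<le> (1 - p / 2) ^ m"
    by (rule upper)
  also have "\<dots> \<le> exp (- (p / 2)) ^ m"
    using p exp_ge_add_one_self[of "- (p / 2)"] by (intro power_mono) auto
  also have "\<dots> = exp (- (p / 2 * m))"
    by (simp add: exp_of_nat_mult[symmetric] mult.commute)
  also have "\<dots> \<le> exp (- 1)"
    using m(1) p by (simp add: field_simps)
  also have "\<dots> \<le> 1 / 2"
    using exp_ge_add_one_self[of 1] by (simp add: exp_minus inverse_eq_divide frac_le)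
  also have "\<dots> \<le> 1 - \<epsilon>"
    using \<epsilon>_le by simp
  finally have "T (1 - \<epsilon>) \<le> 2 * m"
    unfolding T_def mixing_time_def by (rule Least_le)
  then have "real (T (1 - \<epsilon>)) \<le> 2 * real m"
    by (metis of_nat_le_iff of_nat_mult of_nat_numeral)
  also have "\<dots> \<le> 5 / p"
  proof -
    have "2 \<le> 1 / p"
      using p by (simp add: field_simps)
    then show ?thesis
      using m(2) by simp
  qed
  finally have fast: "2 * real (T (1 - \<epsilon>)) \<le> 10 / p"
    by simp
  have "10 / p \<le> T \<epsilon>"
  proof (rule ccontr)
    assume "\<not> 10 / p \<le> T \<epsilon>"
    then have small: "T \<epsilon> * p < 10"
      using p by (simp add: field_simps)
    \<comment> \<open>\<open>T \<epsilon>\<close> is a least time, so some time reaching \<epsilon>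
      must exist before the bound holds at \<open>T \<epsilon>\<close> itself.\<close>
    have "(\<lambda>t. (1 - p / 2) ^ t) \<longlonglongrightarrow> 0"
      using p by (intro LIMSEQ_realpow_zero) auto
    then have "eventually (\<lambda>t. (1 - p / 2) ^ t < \<epsilon>) sequentially"
      using \<epsilon>(1) by (rule order_tendstoD)
    then obtain t where "(1 - p / 2) ^ t < \<epsilon>"
      by (auto simp: eventually_sequentially)
    then have "d (2 * t) \<le> \<epsilon>"
      using upper[of t] by simp
    then have "d (T \<epsilon>) \<le> \<epsilon>"
      unfolding T_def mixing_time_def by (rule LeastI)
    \<comment> \<open>The lower bound is available at even times only. Rounding up costs at most one
      step, which raises the scaled time from 10 to at most 11.\<close>
    moreover define s where "s = (T \<epsilon> + 1) div 2"
    have s: "T \<epsilon> \<le> 2 * s" "2 * s \<le> T \<epsilon> + 1"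
      by (auto simp: s_def)
    ultimately have "exp (- 12 * p) ^ (2 * s) / 2 \<le> \<epsilon>"
      using lower[of s] dist_to_stationary_antimono[OF s(1)] by linarith
    moreover have "exp (- 12 * p) ^ (2 * s) \<ge> exp (- 132)"
    proof -
      have "real (2 * s) * p \<le> (T \<epsilon> + 1) * p"
        using s(2) p by (intro mult_right_mono) (simp_all flip: of_nat_Suc)
      also have "\<dots> \<le> 11"
        using small p by (simp add: algebra_simps)
      finally show ?thesis
        by (simp add: exp_of_nat_mult[symmetric] mult_ac)
    qed
    ultimately show False
      using \<epsilon>(2) by simp
  qed
  then have "real (2 * T (1 - \<epsilon>)) \<le> T \<epsilon>"
    using fast by simp
  then show ?thesis
    unfolding \<epsilon>_def of_nat_le_iff .
qed

end

text \<open>Cutoff fails at the single level \<open>exp (- 134)\<close>: for every \<open>n\<close>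
  from 1 on, the ratio of mixing times is at least 2 or has denominator zero.\<close>

theorem corollary2p3p1:
  fixes G :: "nat \<Rightarrow> ('a, 'b) monoid_scheme"
    and C_star :: "nat \<Rightarrow> 'a set"
    and \<pi> :: "nat \<Rightarrow> 'a \<Rightarrow> real"
  assumes "\<And>n. n \<ge> 1 \<Longrightarrow> CA_group (G n)"
    and "\<And>n. n \<ge> 1 \<Longrightarrow> finite (carrier (G n))"
    and "\<And>n. n \<ge> 1 \<Longrightarrow> \<not> comm_group (G n)"
    and "\<And>n. n \<ge> 1 \<Longrightarrow> \<exists>x \<in> carrier (G n) - center (G n). C_star n = centralizer (G n) x"
    and "\<And>n. n \<ge> 1 \<Longrightarrow> card (C_star n) = max_centralizer_card (G n)"
    and "\<And>n. n \<ge> 1 \<Longrightarrow> stationary_distribution (carrier (G n)) (commuting_chain (G n)) (\<pi> n)"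
    and "\<And>n. n \<ge> 1 \<Longrightarrow> (\<Sum>x \<in> C_star n - center (G n). \<pi> n x) \<le> 1 / 2"
    and "(\<lambda>n. abs_second_eigenvalue (carrier (G n)) (commuting_chain (G n))) \<longlonglongrightarrow> 1"
  shows "\<not> exhibits_cutoff
           (\<lambda>n. mixing_time (carrier (G n)) (commuting_chain (G n)) (\<pi> n))"
proof
  let ?T = "\<lambda>n. mixing_time (carrier (G n)) (commuting_chain (G n)) (\<pi> n)"
  define \<epsilon> :: real where "\<epsilon> = exp (- 134)"
  assume "exhibits_cutoff ?T"
  moreover have "\<epsilon> \<in> {0<..<1}"
    by (simp add: \<epsilon>_def)
  ultimately have "(\<lambda>n. real (?T n \<epsilon>) / real (?T n (1 - \<epsilon>))) \<longlonglongrightarrow> 1"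
    unfolding exhibits_cutoff_def by blast
  \<comment> \<open>The interval excludes 0 as well, since a ratio with denominator zero has the
    value 0.\<close>
  then have near: "eventually (\<lambda>n. real (?T n \<epsilon>) / real (?T n (1 - \<epsilon>)) \<in> {0<..<2}) sequentially"
    by (rule topological_tendstoD) auto
  then obtain n where n: "n \<ge> 1" "real (?T n \<epsilon>) / real (?T n (1 - \<epsilon>)) \<in> {0<..<2}"
    using eventually_conj[OF near eventually_ge_at_top[of 1]] unfolding eventually_sequentially
    by blast
  obtain x where x: "x \<in> carrier (G n) - center (G n)" "C_star n = centralizer (G n) x"
    using assms(4)[OF n(1)] by blast
  have CA: "CA_group (G n)"
    by (rule assms(1)[OF n(1)])
  then interpret group "G n"
    by (simp add: CA_group_def)
  have "2 * ?T n (1 - \<epsilon>) \<le> ?T n \<epsilon>"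
    unfolding \<epsilon>_def
    using commuting_chain_mixing_time_gap[OF CA assms(2)[OF n(1)] x(1) _ assms(6)[OF n(1)]]
      assms(5,7)[OF n(1)] x(2) by simp
  then have "2 * real (?T n (1 - \<epsilon>)) \<le> ?T n \<epsilon>"
    by (metis of_nat_le_iff of_nat_mult of_nat_numeral)
  then show False
    using n(2) by (cases "?T n (1 - \<epsilon>) = 0") (simp_all add: field_simps)
qed

end
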